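(* Let $\mathcal{T}=(\mathcal{V},\mathcal{E})$ be a tree with $\mathcal{V}=\{1,\dots,J\}$ and set of leaves $\mathcal{L}$, and for $j\in\mathcal{V}$ let $\mathcal{N}_j$ denote the set of neighbours of $j$. Let $\epsilon>0$, let $C^{(j_1,j_2)}\in\mathbb{R}_+^{n\times n}$ for $(j_1,j_2)\in\mathcal{E}$ be cost matrices with $C^{(j_2,j_1)}=(C^{(j_1,j_2)})^T$, and let $\mathbf{C}$ be the $J$-mode tensor $\mathbf{C}_{i_1,\dots,i_J}=\sum_{(j_1,j_2)\in\mathcal{E}}C^{(j_1,j_2)}_{i_{j_1},i_{j_2}}$ (each undirected edge counted once). Let $\mathbf{K}=\exp(-\mathbf{C}/\epsilon)$, $K^{(j_1,j_2)}=\exp(-C^{(j_1,j_2)}/\epsilon)$, and let $\mathbf{U}=u_1\otimes u_2\otimes\dots\otimes u_J$ for vectors $u_1,\dots,u_J\in\mathbb{R}^n$. Then for every $j\in\mathcal{V}$ the projection on the $j$-th marginal of $\mathbf{K}\odot\mathbf{U}$ is $$P_j(\mathbf{K}\odot\mathbf{U})=u_j\odot\bigodot_{k\in\mathcal{N}_j}\alpha_{(j,k)},$$ where the vectors $\alpha_{(j,k)}\in\mathbb{R}^n$, for all ordered pairs $(j,k)$ of adjacent vertices, are computed recursively starting in the leaves of the tree according to $$\alpha_{(j,k)}=K^{(j,k)}u_k\quad\text{if }k\in\mathcal{L},\qquad \alpha_{(j,k)}=K^{(j,k)}\Big(u_k\odot\bigodot_{\ell\in\mathcal{N}_k\setminus\{j\}}\alpha_{(k,\ell)}\Big)\quad\text{if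 }k\notin\mathcal{L}.$$
   Context: $\exp$ and $\odot$ (and $\bigodot$) act elementwise on vectors, matrices and tensors; $\otimes$ is the outer product, so $\mathbf{U}_{i_1,\dots,i_J}=\prod_{j}(u_j)_{i_j}$. Leaves are the vertices of degree 1. All indices $i_j$ range over $\{1,\dots,n\}$. For a tensor $\mathbf{M}\in\mathbb{R}^{n\times\dots\times n}$ with $J$ modes, $P_j(\mathbf{M})\in\mathbb{R}^n$ is defined by summing out all indices but the $j$-th: $P_j(\mathbf{M})_{i_j}=\sum_{i_1,\dots,i_{j-1},i_{j+1},\dots,i_J}\mathbf{M}_{i_1,\dots,i_J}$. *)

theory Defs
  imports "HOL-Analysis.Analysis" "Graph_Theory.Digraph_Component"
begin

text \<open>
  An undirected graph is a symmetric digraph, so every edge occurs in \<open>parcs G\<close> in both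
  directions. The library's \<open>tree\<close> and \<open>forest\<close> forbid directed cycles, which includes the
  walks \<open>a, b, a\<close> along a single edge; hence no symmetric digraph with an edge is a library tree.
  In a graph, the directed cycles of length at least 3 are exactly the cycles of the
  undirected graph, traversed in one of their two directions.
\<close>

definition undirected_tree :: "'a pair_pre_digraph \<Rightarrow> bool" where
  "undirected_tree G \<longleftrightarrow>
     pair_graph G \<and> Digraph_Component.connected (with_proj G) \<and>
     \<not> (\<exists>p. pre_digraph.cycle (with_proj G) p \<and> 3 \<le> length p)"

definition neighbours :: "'a pair_pre_digraph \<Rightarrow> 'a \<Rightarrow> 'a set" where
  "neighbours G j = {k. (j, k) \<in> parcs G}"

definition leaves :: "'a pair_pre_digraph \<Rightarrow> 'a set" where
  "leaves G = {j \<in> pverts G. card (neighbours G j) = 1}"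

text \<open>
  The index range \<open>{1..n}\<close> is the finite type \<open>'n\<close>. A tensor with modes \<open>1, \<dots>, J\<close> is a
  function on multi-indices \<open>i\<close>, where \<open>i j\<close> is the index of mode \<open>j\<close>; only its values on
  \<open>multi_indices J\<close> matter. The operations \<open>*\<close> and \<open>\<Prod>\<close> on \<open>real^'n\<close> are the
  componentwise (Hadamard) ones.
\<close>

type_synonym 'n tensor = "(nat \<Rightarrow> 'n) \<Rightarrow> real"

definition multi_indices :: "nat \<Rightarrow> (nat \<Rightarrow> 'n::finite) set" where
  "multi_indices J = {1..J} \<rightarrow>\<^sub>E UNIV"

definition tensor_hadamard :: "'n tensor \<Rightarrow> 'n tensor \<Rightarrow> 'n tensor"  (infixl \<open>\<odot>\<close> 70) where
  "M \<odot> N = (\<lambda>i. M i * N i)"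

definition outer_product :: "nat \<Rightarrow> (nat \<Rightarrow> real^'n) \<Rightarrow> 'n::finite tensor" where
  "outer_product J u = (\<lambda>i. \<Prod>j=1..J. u j $ i j)"

definition tensor_proj :: "nat \<Rightarrow> nat \<Rightarrow> 'n::finite tensor \<Rightarrow> real^'n" where
  "tensor_proj J j M = (\<chi> a. \<Sum>i | i \<in> multi_indices J \<and> i j = a. M i)"

text \<open>
  Restricting to arcs with \<open>j1 < j2\<close> counts each undirected edge once.
\<close>

definition cost_tensor ::
    "nat pair_pre_digraph \<Rightarrow> (nat \<Rightarrow> nat \<Rightarrow> real^'n^'n) \<Rightarrow> 'n::finite tensor" where
  "cost_tensor G C =
     (\<lambda>i. \<Sum>(j1, j2) | (j1, j2) \<in> parcs G \<and> j1 < j2. C j1 j2 $ i j1 $ i j2)"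

text \<open>Exponentials are elementwise, unlike the Banach-algebra function \<open>exp\<close> of the library.\<close>

definition gibbs_tensor :: "real \<Rightarrow> 'n tensor \<Rightarrow> 'n tensor" where
  "gibbs_tensor \<epsilon> C = (\<lambda>i. exp (- C i / \<epsilon>))"

definition gibbs_matrix :: "real \<Rightarrow> real^'n^'m \<Rightarrow> real^'n^'m" where
  "gibbs_matrix \<epsilon> C = (\<chi> a b. exp (- (C $ a $ b) / \<epsilon>))"

text \<open>
  \<open>K j k\<close> and \<open>\<alpha> j k\<close> are only constrained for ordered pairs \<open>(j, k)\<close> of adjacent vertices.
\<close>

definition alpha_recursion ::
    "nat pair_pre_digraph \<Rightarrow> (nat \<Rightarrow> nat \<Rightarrow> real^'n^'n) \<Rightarrow> (nat \<Rightarrow> real^'n) \<Rightarrow>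
     (nat \<Rightarrow> nat \<Rightarrow> real^'n::finite) \<Rightarrow> bool" where
  "alpha_recursion G K u \<alpha> \<longleftrightarrow>
     (\<forall>j k. (j, k) \<in> parcs G \<longrightarrow>
        \<alpha> j k =
          (if k \<in> leaves G then K j k *v u k
           else K j k *v (u k * (\<Prod>l\<in>neighbours G k - {j}. \<alpha> k l))))"

end

theory Submission
  imports Defs
begin

text \<open>
  A tree grows from any root \<open>r\<close> by attaching one new leaf at a time. For a partially grown
  tree \<open>S\<close>, sum over the indices of the vertices of \<open>S\<close> the product of the edge weights inside \<open>S\<close>
  and of the vertex weights, where every branch cut off by \<open>S\<close> is replaced by its message \<open>\<alpha>\<close>.
  Attaching a leaf does not change this sum: summing out the index of the leaf is exactly one
  step of the recursion for \<open>\<alpha>\<close>. For \<open>S = {r}\<close> the sum is the claimed formula, for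
  \<open>S = \<V>\<close> it is the marginal.
\<close>

section \<open>Growing a tree by attaching leaves\<close>

inductive grown :: "'a pair_pre_digraph \<Rightarrow> 'a \<Rightarrow> 'a set \<Rightarrow> bool" for G r where
  root: "grown G r {r}"
| attach: "grown G r (insert w S)"
  if "grown G r S" "w \<notin> S" "neighbours G w \<inter> S = {v}"

lemma grown_finite: "grown G r S \<Longrightarrow> finite S"
  by (induction rule: grown.induct) auto

lemma root_in_grown: "grown G r S \<Longrightarrow> r \<in> S"
  by (induction rule: grown.induct) auto

lemma (in pair_graph) neighbours_commute: "k \<in> neighbours G j \<longleftrightarrow> j \<in> neighbours G k"
  using pair_sym_arcs by (auto simp: neighbours_def symmetric_def dest: symD)

lemma (in pair_graph) not_neighbours_self: "j \<notin> neighbours G j"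
  using pair_no_loops[of "(j, j)"] by (auto simp: neighbours_def)

lemma (in pair_graph) finite_neighbours: "finite (neighbours G j)"
proof (rule finite_subset)
  show "neighbours G j \<subseteq> snd ` parcs G"
    by (force simp: neighbours_def)
qed (use pair_finite_arcs in auto)

text \<open>Supplies the path inside \<open>S\<close> from which a forbidden cycle is built below. A
  path that starts or ends at the new vertex \<open>w\<close> passes through its neighbour
  \<open>v\<close>; since \<open>w\<close> is not in \<open>S\<close>, no vertex repeats.\<close>

lemma (in pair_graph) grown_apath:
  assumes "grown G r S" "S \<subseteq> pverts G" "x \<in> S" "y \<in> S"
  shows "\<exists>p. apath x p y \<and> set (awalk_verts x p) \<subseteq> S"
  using assms
proof (induction arbitrary: x y rule: grown.induct)
  case root
  then show ?case
    by (intro exI[of _ "[]"]) (auto simp: apath_Nil_iff)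
next
  case (attach S w v)
  have vS: "v \<in> S" and wv: "(w, v) \<in> parcs G" "(v, w) \<in> parcs G"
    using attach.hyps neighbours_commute[of v w] by (auto simp: neighbours_def)
  consider "x \<in> S" "y \<in> S" | "x = w" "y = w" | "x = w" "y \<in> S" | "x \<in> S" "y = w"
    using attach.prems by auto
  then show ?case
  proof cases
    case 1
    then show ?thesis using attach.IH[of x y] attach.prems by auto
  next
    case 2
    then show ?thesis
      using attach.prems by (intro exI[of _ "[]"]) (auto simp: apath_Nil_iff)
  next
    case 3
    then obtain p where "apath v p y" "set (awalk_verts v p) \<subseteq> S"
      using attach.IH[of v y] attach.prems vS by auto
    then show ?thesis
      using 3 wv attach.hyps by (intro exI[of _ "(w, v) # p"]) (auto simp: apath_Cons_iff)
  next
    case 4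
    then obtain p where p: "apath x p v" "set (awalk_verts x p) \<subseteq> S"
      using attach.IH[of x v] attach.prems vS by auto
    then have "awalk x p v" by (simp add: apath_def)
    moreover have "awalk v [(v, w)] w"
      using wv attach.prems by (auto simp: awalk_Cons_iff awalk_Nil_iff)
    ultimately have "awalk x (p @ [(v, w)]) w"
      and "awalk_verts x (p @ [(v, w)]) = awalk_verts x p @ [w]"
      by (auto simp: awalk_verts_append)
    then show ?thesis
      using 4 p attach.hyps by (intro exI[of _ "p @ [(v, w)]"]) (auto simp: apath_def)
  qed
qed

text \<open>Two distinct neighbours of \<open>w\<close> in \<open>S\<close> are joined by a path
  inside \<open>S\<close>, and closing it through \<open>w\<close> gives a cycle. The path has at
  least one arc, so the cycle has length at least 3.\<close>

lemma (in pair_graph) grown_attachment_unique: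
  assumes "grown G r S" "S \<subseteq> pverts G" "w \<notin> S"
    and v: "v \<in> neighbours G w" "v \<in> S" and x: "x \<in> neighbours G w" "x \<in> S"
    and no_cycle: "\<nexists>p. cycle p \<and> 3 \<le> length p"
  shows "x = v"
proof (rule ccontr)
  assume "x \<noteq> v"
  obtain p where p: "apath v p x" "set (awalk_verts v p) \<subseteq> S"
    using grown_apath[OF assms(1,2) v(2) x(2)] by auto
  have arcs: "(w, v) \<in> parcs G" "(x, w) \<in> parcs G"
    using v x neighbours_commute[of x w] by (auto simp: neighbours_def)
  then have w: "w \<in> pverts G"
    by (auto dest: wellformed')
  have walk: "awalk v p x" "awalk x [(x, w)] w"
    using p arcs w by (auto simp: apath_def awalk_Cons_iff awalk_Nil_iff)
  then have "awalk w ((w, v) # p @ [(x, w)]) w"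
    using arcs by (auto simp: awalk_Cons_iff)
  \<comment> \<open>\<open>cycle\<close> asks for distinct vertices only after the first one, so the
    closed walk may start and end in \<open>w\<close>.\<close>
  moreover have "awalk_verts v (p @ [(x, w)]) = awalk_verts v p @ [w]"
    using walk by (subst awalk_verts_append) auto
  then have "distinct (tl (awalk_verts w ((w, v) # p @ [(x, w)])))"
    using p assms(3) by (auto simp: apath_def)
  ultimately have "cycle ((w, v) # p @ [(x, w)])"
    unfolding cycle_def by blast
  moreover have "p \<noteq> []"
    using p(1) \<open>x \<noteq> v\<close> by (auto simp: apath_Nil_iff)
  then have "3 \<le> length ((w, v) # p @ [(x, w)])"
    by (cases p) auto
  ultimately show False using no_cycle by blast
qed

text \<open>Take a grown vertex set of maximal cardinality. If it missed a vertex, connectedness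
  would give an arc \<open>(v, w)\<close> leaving it; acyclicity makes \<open>v\<close> the only
  neighbour of \<open>w\<close> inside, so \<open>w\<close> could be attached.\<close>

lemma undirected_tree_grown:
  assumes tree: "undirected_tree G" and r: "r \<in> pverts G"
  shows "grown G r (pverts G)"
proof -
  interpret pair_graph G using tree by (simp add: undirected_tree_def)
  have no_cycle: "\<nexists>p. cycle p \<and> 3 \<le> length p"
    using tree by (simp add: undirected_tree_def)
  have "strongly_connected (with_proj G)"
    using tree pair_sym_arcs by (simp add: undirected_tree_def symmetric_connected_imp_strongly_connected)
  then have reach: "r \<rightarrow>\<^sup>*\<^bsub>with_proj G\<^esub> y" if "y \<in> pverts G" for y
    using r that by (auto simp: strongly_connected_def)
  define P where "P S \<longleftrightarrow> grown G r S \<and> S \<subseteq> pverts G" for S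
  have "P {r}" using r by (auto simp: P_def intro: root)
  moreover have "\<forall>S. P S \<longrightarrow> card S < Suc (card (pverts G))"
    using pair_finite_verts by (auto simp: P_def less_Suc_eq_le intro: card_mono)
  ultimately obtain S where S: "P S" and max: "\<And>T. P T \<Longrightarrow> card T \<le> card S"
    using ex_has_greatest_nat[of P "{r}" card "Suc (card (pverts G))"] by blast
  have "S = pverts G"
  proof (rule ccontr)
    assume "S \<noteq> pverts G"
    then obtain y where y: "y \<in> pverts G" "y \<notin> S" using S by (auto simp: P_def)
    \<comment> \<open>Along a walk from \<open>r\<close>, either the current vertex lies in
      \<open>S\<close> or some arc leaves \<open>S\<close>. At the missing vertex \<open>y\<close>
      only the second is possible.\<close>
    have "z \<in> S \<or> (\<exists>v w. v \<in> S \<and> w \<notin> S \<and> (v, w) \<in> parcs G)" if "r \<rightarrow>\<^sup>*\<^bsub>with_proj G\<^esub> z" for z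
      using that
    proof (induction rule: reachable_induct)
      case base
      then show ?case using S root_in_grown by (auto simp: P_def)
    next
      case (step a b)
      then show ?case by auto
    qed
    then obtain v w where vw: "v \<in> S" "w \<notin> S" "(v, w) \<in> parcs G"
      using reach y by blast
    then have v: "v \<in> neighbours G w"
      using neighbours_commute[of v w] by (auto simp: neighbours_def)
    have "x = v" if "x \<in> neighbours G w" "x \<in> S" for x
      using grown_attachment_unique[OF _ _ vw(2) v vw(1) that no_cycle, of r] S by (simp add: P_def)
    then have "neighbours G w \<inter> S = {v}"
      using v vw by blast
    then have "P (insert w S)"
      using S vw by (auto simp: P_def intro: attach dest: wellformed')
    then have "card (insert w S) \<le> card S" by (rule max)
    then show False using S vw grown_finite[of G r S] by (auto simp: P_def)
  qed
  then show ?thesis using S by (simp add: P_def)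
qed

section \<open>Well-foundedness of the message recursion\<close>

text \<open>The message of the arc \<open>(j, k)\<close> calls those of the arcs
  \<open>(k, l)\<close> with \<open>l \<noteq> j\<close>; a decreasing rank makes this recursion
  well-founded. When a leaf is attached, the arc into it calls nothing and goes to the bottom, while
  the arc out of it is called by nothing and goes to the top.\<close>

lemma (in pair_graph) grown_arc_rank:
  assumes "grown G r S"
  shows "\<exists>rank :: 'a \<Rightarrow> 'a \<Rightarrow> nat. \<forall>j\<in>S. \<forall>k\<in>S. \<forall>l\<in>S.
    k \<in> neighbours G j \<longrightarrow> l \<in> neighbours G k \<longrightarrow> l \<noteq> j \<longrightarrow> rank k l < rank j k"
  using assms
proof (induction rule: grown.induct)
  case root
  then show ?case by auto
next
  case (attach S w v)
  then obtain rank :: "'a \<Rightarrow> 'a \<Rightarrow> nat" where rank: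
    "\<And>j k l. \<lbrakk>j \<in> S; k \<in> S; l \<in> S; k \<in> neighbours G j; l \<in> neighbours G k; l \<noteq> j\<rbrakk>
      \<Longrightarrow> rank k l < rank j k"
    by blast
  have nb: "x = v" if "x \<in> insert w S" "x \<in> neighbours G w \<or> w \<in> neighbours G x" for x
    using that attach.hyps not_neighbours_self[of w] neighbours_commute[of x w] by auto
  define m where "m = Max (case_prod rank ` (S \<times> S))"
  have m: "rank x y \<le> m" if "x \<in> S" "y \<in> S" for x y
    unfolding m_def using that grown_finite[OF attach.hyps(1)] by (auto intro!: Max_ge)
  \<comment> \<open>Old ranks move up by one into the range from 1 to \<open>m + 1\<close>, which
    leaves 0 free below them and \<open>m + 2\<close> above them.\<close>
  define rank' where
    "rank' x y = (if y = w then 0 else if x = w then m + 2 else Suc (rank x y))" for x y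
  have "rank' k l < rank' j k"
    if jkl: "j \<in> insert w S" "k \<in> insert w S" "l \<in> insert w S"
      "k \<in> neighbours G j" "l \<in> neighbours G k" "l \<noteq> j" for j k l
  proof (cases "k = w")
    case True
    then show ?thesis using nb jkl by metis
  next
    case False
    then have "k \<in> S" using jkl by simp
    then show ?thesis
      using False jkl rank[of j k l] m[of k l] by (auto simp: rank'_def)
  qed
  then show ?case by blast
qed

section \<open>Sums over multi-indices and weights of partial trees\<close>

text \<open>A multi-index on \<open>insert w S\<close> is a multi-index on \<open>S\<close> together
  with an index \<open>b\<close> for \<open>w\<close>. Since \<open>r\<close> lies in
  \<open>S\<close>, it differs from \<open>w\<close>, and the constraint at \<open>r\<close>
  survives the update.\<close>

lemma sum_PiE_insert:
  fixes f :: "('a \<Rightarrow> 'n::finite) \<Rightarrow> 'r::comm_monoid_add"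
  assumes "w \<notin> S" "r \<in> S"
  shows "(\<Sum>i | i \<in> insert w S \<rightarrow>\<^sub>E UNIV \<and> i r = a. f i) =
    (\<Sum>i | i \<in> S \<rightarrow>\<^sub>E UNIV \<and> i r = a. \<Sum>b\<in>UNIV. f (i(w := b)))"
proof -
  let ?I = "{i \<in> S \<rightarrow>\<^sub>E (UNIV :: 'n set). i r = a}"
  let ?h = "\<lambda>(b, i). i(w := b)"
  have "inj_on ?h (UNIV \<times> ?I)"
    by (rule inj_on_subset[OF inj_combinator[OF assms(1), of "\<lambda>_. UNIV"]]) auto
  moreover have "{i \<in> insert w S \<rightarrow>\<^sub>E UNIV. i r = a} = ?h ` (UNIV \<times> ?I)"
    using assms by (auto simp: PiE_insert_eq image_iff)
  ultimately have "(\<Sum>i | i \<in> insert w S \<rightarrow>\<^sub>E UNIV \<and> i r = a. f i) = (\<Sum>(b, i)\<in>UNIV \<times> ?I. f (i(w := b)))"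
    by (simp add: sum.reindex case_prod_unfold)
  also have "\<dots> = (\<Sum>b\<in>UNIV. \<Sum>i\<in>?I. f (i(w := b)))"
    by (simp add: sum.cartesian_product)
  also have "\<dots> = (\<Sum>i\<in>?I. \<Sum>b\<in>UNIV. f (i(w := b)))"
    by (rule sum.swap)
  finally show ?thesis .
qed

text \<open>Only sums and products of entries matter, so matrices and vectors become functions into
  a commutative semiring. The linear order selects one direction of each edge, and
  \<open>K_sym\<close> makes the choice immaterial.\<close>

locale tree_messages = pair_graph G
  for G :: "'a::linorder pair_pre_digraph" +
  fixes K :: "'a \<Rightarrow> 'a \<Rightarrow> 'n::finite \<Rightarrow> 'n \<Rightarrow> 'r::comm_semiring_1"
    and u :: "'a \<Rightarrow> 'n \<Rightarrow> 'r"
    and \<alpha> :: "'a \<Rightarrow> 'a \<Rightarrow> 'n \<Rightarrow> 'r"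
  assumes K_sym: "(j, k) \<in> parcs G \<Longrightarrow> K k j b a = K j k a b"
    and \<alpha>: "(j, k) \<in> parcs G \<Longrightarrow>
      \<alpha> j k a = (\<Sum>b\<in>UNIV. K j k a b * (u k b * (\<Prod>l\<in>neighbours G k - {j}. \<alpha> k l b)))"
begin

definition vertex_weight :: "'a set \<Rightarrow> ('a \<Rightarrow> 'n) \<Rightarrow> 'a \<Rightarrow> 'r" where
  "vertex_weight S i v = u v (i v) * (\<Prod>l\<in>neighbours G v - S. \<alpha> v l (i v))"

definition edges :: "'a set \<Rightarrow> ('a \<times> 'a) set" where
  "edges S = {(x, y) \<in> parcs G. x < y \<and> x \<in> S \<and> y \<in> S}"

definition weight :: "'a set \<Rightarrow> ('a \<Rightarrow> 'n) \<Rightarrow> 'r" where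
  "weight S i = (\<Prod>v\<in>S. vertex_weight S i v) * (\<Prod>(x, y)\<in>edges S. K x y (i x) (i y))"

section \<open>Attaching one leaf\<close>

context
  fixes S w v
  assumes fin: "finite S" and w: "w \<notin> S" and v: "neighbours G w \<inter> S = {v}"
begin

text \<open>Seen from \<open>w\<close>, every branch except the one through \<open>v\<close> is
  still cut off, so exactly the product in the recursion for \<open>\<alpha> v w\<close>
  remains.\<close>

lemma vertex_weight_insert_new:
  "vertex_weight (insert w S) (i(w := b)) w = u w b * (\<Prod>l\<in>neighbours G w - {v}. \<alpha> w l b)"
proof -
  have "neighbours G w - insert w S = neighbours G w - {v}"
    using v not_neighbours_self[of w] by auto
  then show ?thesis by (simp add: vertex_weight_def)
qed

text \<open>Among the vertices of \<open>S\<close> only \<open>v\<close> is adjacent to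
  \<open>w\<close>, so only \<open>v\<close> loses a message.\<close>

lemma vertex_weight_insert_old:
  assumes "x \<in> S"
  shows "vertex_weight S i x =
    (if x = v then \<alpha> v w (i v) else 1) * vertex_weight (insert w S) (i(w := b)) x"
proof (cases "x = v")
  case True
  have "w \<in> neighbours G v" using v neighbours_commute[of w v] by auto
  then have "(\<Prod>l\<in>neighbours G v - S. \<alpha> v l (i v)) =
    \<alpha> v w (i v) * (\<Prod>l\<in>neighbours G v - S - {w}. \<alpha> v l (i v))"
    using w finite_neighbours[of v] by (intro prod.remove) auto
  moreover have "neighbours G v - S - {w} = neighbours G v - insert w S" by auto
  moreover have "v \<noteq> w" using assms True w by auto
  ultimately have "vertex_weight S i v = \<alpha> v w (i v) * vertex_weight (insert w S) (i(w := b)) v"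
    by (simp add: vertex_weight_def mult_ac)
  then show ?thesis using True by simp
next
  case False
  then have "w \<notin> neighbours G x"
    using v assms neighbours_commute[of w x] by auto
  then have "neighbours G x - S = neighbours G x - insert w S" by auto
  moreover have "x \<noteq> w" using assms w by auto
  ultimately show ?thesis
    using False by (simp only: vertex_weight_def fun_upd_other if_False mult_1_left not_False_eq_True)
qed

lemma prod_vertex_weight:
  "(\<Prod>x\<in>S. vertex_weight S i x) =
    \<alpha> v w (i v) * (\<Prod>x\<in>S. vertex_weight (insert w S) (i(w := b)) x)"
proof -
  have "v \<in> S" using v by auto
  have "(\<Prod>x\<in>S. vertex_weight S i x) =
    (\<Prod>x\<in>S. (if x = v then \<alpha> v w (i v) else 1) * vertex_weight (insert w S) (i(w := b)) x)"
    by (rule prod.cong) (simp_all only: vertex_weight_insert_old)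
  also have "\<dots> = \<alpha> v w (i v) * (\<Prod>x\<in>S. vertex_weight (insert w S) (i(w := b)) x)"
    using fin \<open>v \<in> S\<close> by (simp add: prod.distrib)
  finally show ?thesis .
qed

lemma prod_edges_insert:
  "(\<Prod>(x, y)\<in>edges (insert w S). K x y ((i(w := b)) x) ((i(w := b)) y)) =
    K v w (i v) b * (\<Prod>(x, y)\<in>edges S. K x y (i x) (i y))"
proof -
  have "v \<in> S" "v \<noteq> w" using v w by auto
  have arcs: "(w, x) \<in> parcs G \<longleftrightarrow> x = v" "(x, w) \<in> parcs G \<longleftrightarrow> x = v" if "x \<in> S" for x
    using that v neighbours_commute[of w x] by (auto simp: neighbours_def)
  have loop: "(w, w) \<notin> parcs G"
    using not_neighbours_self[of w] by (simp add: neighbours_def)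
  have edges: "edges (insert w S) = insert (min v w, max v w) (edges S)"
    using arcs loop \<open>v \<in> S\<close> \<open>v \<noteq> w\<close> by (auto simp: edges_def min_def max_def)
  have fin_edges: "finite (edges S)"
    by (rule finite_subset[OF _ pair_finite_arcs]) (auto simp: edges_def)
  have new: "(min v w, max v w) \<notin> edges S"
    using w by (auto simp: edges_def min_def max_def)
  have old: "(\<Prod>(x, y)\<in>edges S. K x y ((i(w := b)) x) ((i(w := b)) y)) =
    (\<Prod>(x, y)\<in>edges S. K x y (i x) (i y))"
    using w by (intro prod.cong) (auto simp: edges_def)
  \<comment> \<open>If \<open>w < v\<close>, the new edge is stored as \<open>(w, v)\<close>, and
    \<open>K_sym\<close> turns its factor around.\<close>
  have "K (min v w) (max v w) ((i(w := b)) (min v w)) ((i(w := b)) (max v w)) = K v w (i v) b"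
    using K_sym[of v w b "i v"] arcs[OF \<open>v \<in> S\<close>] \<open>v \<noteq> w\<close> by (auto simp: min_def max_def)
  then show ?thesis
    using fin_edges new by (simp add: edges old del: fun_upd_apply)
qed

text \<open>The factors that depend on \<open>b\<close> are the new edge and the new vertex weight.
  Their sum over \<open>b\<close> is the right-hand side of the recursion for
  \<open>\<alpha> v w\<close>, the very message that \<open>v\<close> carries before the
  attachment.\<close>

lemma sum_weight_insert: "(\<Sum>b\<in>UNIV. weight (insert w S) (i(w := b))) = weight S i"
proof -
  have vw: "(v, w) \<in> parcs G"
    using v neighbours_commute[of v w] by (auto simp: neighbours_def)
  define rest where "rest b = (\<Prod>x\<in>S. vertex_weight (insert w S) (i(w := b)) x) *
    (\<Prod>(x, y)\<in>edges S. K x y (i x) (i y))" for b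
  \<comment> \<open>Vertices of \<open>S\<close> differ from \<open>w\<close>, so \<open>b\<close>
    does not enter; \<open>undefined\<close> is just a fixed index that lets this factor leave the
    sum.\<close>
  have rest: "rest b = rest undefined" for b
  proof -
    have "vertex_weight (insert w S) (i(w := b)) x =
      vertex_weight (insert w S) (i(w := undefined)) x" if "x \<in> S" for x
      using that w by (auto simp: vertex_weight_def)
    then show ?thesis unfolding rest_def by (metis (no_types, lifting) prod.cong)
  qed
  have "weight (insert w S) (i(w := b)) =
    K v w (i v) b * (u w b * (\<Prod>l\<in>neighbours G w - {v}. \<alpha> w l b)) * rest undefined" for b
  proof -
    have "weight (insert w S) (i(w := b)) =
      K v w (i v) b * (u w b * (\<Prod>l\<in>neighbours G w - {v}. \<alpha> w l b)) * rest b"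
      unfolding weight_def rest_def prod.insert[OF fin w] vertex_weight_insert_new prod_edges_insert
      by (simp only: mult_ac)
    then show ?thesis using rest[of b] by simp
  qed
  then have "(\<Sum>b\<in>UNIV. weight (insert w S) (i(w := b))) = \<alpha> v w (i v) * rest undefined"
    by (simp only: \<alpha>[OF vw] sum_distrib_right)
  also have "\<dots> = weight S i"
    unfolding weight_def rest_def prod_vertex_weight[of i undefined] by (simp only: mult.assoc)
  finally show ?thesis .
qed

end

lemma grown_sum_weight:
  assumes "grown G r S"
  shows "(\<Sum>i | i \<in> S \<rightarrow>\<^sub>E UNIV \<and> i r = a. weight S i) =
    u r a * (\<Prod>k\<in>neighbours G r. \<alpha> r k a)"
  using assms
proof (induction rule: grown.induct)
  case root
  \<comment> \<open>Functions in \<open>PiE\<close> are \<open>undefined\<close> off their domain,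
    so fixing the value at \<open>r\<close> leaves a single multi-index.\<close>
  have "{i. i \<in> {r} \<rightarrow>\<^sub>E (UNIV :: 'n set) \<and> i r = a} = {(\<lambda>_. undefined)(r := a)}"
    by (auto simp: PiE_insert_eq)
  moreover have "edges {r} = {}" "neighbours G r - {r} = neighbours G r"
    using not_neighbours_self[of r] by (auto simp: edges_def)
  ultimately show ?case by (simp add: weight_def vertex_weight_def)
next
  case (attach S w v)
  note S = grown_finite[OF attach.hyps(1)] root_in_grown[OF attach.hyps(1)]
  have "(\<Sum>i | i \<in> insert w S \<rightarrow>\<^sub>E UNIV \<and> i r = a. weight (insert w S) i) =
    (\<Sum>i | i \<in> S \<rightarrow>\<^sub>E UNIV \<and> i r = a. weight S i)"
    using S attach.hyps by (simp add: sum_PiE_insert sum_weight_insert del: fun_upd_apply)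
  then show ?case using attach.IH by simp
qed

text \<open>No vertex has a neighbour outside \<open>pverts G\<close>, so all messages have
  disappeared.\<close>

lemma weight_pverts:
  "weight (pverts G) i = (\<Prod>v\<in>pverts G. u v (i v)) *
    (\<Prod>(x, y) | (x, y) \<in> parcs G \<and> x < y. K x y (i x) (i y))"
proof -
  have "vertex_weight (pverts G) i v = u v (i v)" for v
  proof -
    have "neighbours G v - pverts G = {}"
      by (auto simp: neighbours_def dest: wellformed')
    then show ?thesis by (simp only: vertex_weight_def prod.empty mult_1_right)
  qed
  moreover have "edges (pverts G) = {(x, y). (x, y) \<in> parcs G \<and> x < y}"
    by (auto simp: edges_def dest: wellformed')
  ultimately show ?thesis
    by (simp add: weight_def)
qed

end

section \<open>The message recursion: uniform form and existence\<close>

lemma (in pair_graph) neighbours_leaf: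
  assumes "k \<in> leaves G" "(j, k) \<in> parcs G"
  shows "neighbours G k = {j}"
proof -
  have "j \<in> neighbours G k"
    using assms neighbours_commute[of j k] by (auto simp: neighbours_def)
  moreover have "card (neighbours G k) = 1" using assms by (simp add: leaves_def)
  ultimately show ?thesis by (metis card_1_singletonE singletonD)
qed

text \<open>
  A leaf has no neighbour but \<open>j\<close>, so its product of messages is empty.
\<close>

lemma alpha_recursion_iff:
  assumes "pair_graph G"
  shows "alpha_recursion G K u \<alpha> \<longleftrightarrow> (\<forall>j k. (j, k) \<in> parcs G \<longrightarrow>
    \<alpha> j k = K j k *v (u k * (\<Prod>l\<in>neighbours G k - {j}. \<alpha> k l)))"
proof -
  interpret pair_graph G by fact
  have "(if k \<in> leaves G then K j k *v u k
      else K j k *v (u k * (\<Prod>l\<in>neighbours G k - {j}. \<alpha> k l))) =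
    K j k *v (u k * (\<Prod>l\<in>neighbours G k - {j}. \<alpha> k l))"
    if "(j, k) \<in> parcs G" for j k
    using neighbours_leaf[OF _ that] by simp
  then show ?thesis unfolding alpha_recursion_def by (simp cong: imp_cong)
qed

text \<open>Well-founded recursion on arcs, ordered by the rank obtained from growing the tree from
  any root.\<close>

lemma alpha_recursion_exists:
  assumes "undirected_tree G"
  shows "\<exists>\<alpha>. alpha_recursion G K u \<alpha>"
proof -
  interpret pair_graph G using assms by (simp add: undirected_tree_def)
  have "pverts G \<noteq> {}"
    using assms by (auto simp: undirected_tree_def connected_def strongly_connected_def)
  then obtain r where "grown G r (pverts G)"
    using undirected_tree_grown[OF assms] by auto
  then obtain rank :: "nat \<Rightarrow> nat \<Rightarrow> nat" where rank:
    "\<And>j k l. \<lbrakk>j \<in> pverts G; k \<in> pverts G; l \<in> pverts G; k \<in> neighbours G j;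
      l \<in> neighbours G k; l \<noteq> j\<rbrakk> \<Longrightarrow> rank k l < rank j k"
    using grown_arc_rank by blast
  let ?R = "Wellfounded.measure (case_prod rank)"
  \<comment> \<open>The rank is known to decrease only from arc to arc. The default 0 elsewhere
    keeps \<open>F\<close> from consulting its argument there, as \<open>adm_wf\<close>
    requires.\<close>
  define F where "F \<alpha> = (\<lambda>(j, k). if (j, k) \<in> parcs G
    then K j k *v (u k * (\<Prod>l\<in>neighbours G k - {j}. \<alpha> (k, l))) else 0)" for \<alpha>
  have "adm_wf ?R F"
    unfolding adm_wf_def
  proof (intro allI impI)
    fix f g :: "nat \<times> nat \<Rightarrow> real^'a" and x
    assume eq: "\<forall>z. (z, x) \<in> ?R \<longrightarrow> f z = g z"
    obtain j k where x: "x = (j, k)" by (cases x)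
    have "f (k, l) = g (k, l)" if "(j, k) \<in> parcs G" "l \<in> neighbours G k - {j}" for l
    proof -
      have "rank k l < rank j k"
        using that by (intro rank) (auto simp: neighbours_def dest: wellformed')
      then show ?thesis using eq x by auto
    qed
    then show "F f x = F g x" by (simp add: F_def x)
  qed
  then have fix_eq: "wfrec ?R F = F (wfrec ?R F)"
    by (intro wfrec_fixpoint) auto
  have "alpha_recursion G K u (curry (wfrec ?R F))"
    unfolding alpha_recursion_iff[OF pair_graph_axioms] curry_def
  proof (intro allI impI)
    fix j k assume "(j, k) \<in> parcs G"
    then show "wfrec ?R F (j, k) =
      K j k *v (u k * (\<Prod>l\<in>neighbours G k - {j}. wfrec ?R F (k, l)))"
      by (subst fix_eq) (simp add: F_def)
  qed
  then show ?thesis by blast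
qed

section \<open>The Gibbs tensor and its marginals\<close>

text \<open>The exponential turns the sum of edge costs into a product, which is the edge product of
  the full tree's weight.\<close>

lemma gibbs_tensor_cost:
  assumes "finite (parcs G)"
  shows "gibbs_tensor \<epsilon> (cost_tensor G C) i =
    (\<Prod>(j, k) | (j, k) \<in> parcs G \<and> j < k. gibbs_matrix \<epsilon> (C j k) $ i j $ i k)"
proof -
  have "finite {(j, k). (j, k) \<in> parcs G \<and> j < k}"
    by (rule finite_subset[OF _ assms]) auto
  then show ?thesis
    unfolding gibbs_tensor_def cost_tensor_def gibbs_matrix_def
    by (simp add: exp_sum sum_negf[symmetric] sum_divide_distrib case_prod_unfold)
qed

lemma prod_vec_nth: "(\<Prod>k\<in>A. f k) $ a = (\<Prod>k\<in>A. f k $ a)"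
  for f :: "'b \<Rightarrow> ('c::comm_semiring_1)^'n"
  by (induction A rule: infinite_finite_induct) simp_all

theorem theorem3p2:
  fixes J :: nat
    and G :: "nat pair_pre_digraph"
    and \<epsilon> :: real
    and C :: "nat \<Rightarrow> nat \<Rightarrow> real^'n^'n"
    and u :: "nat \<Rightarrow> real^'n"
  assumes "undirected_tree G"
    and "pverts G = {1..J}"
    and "\<epsilon> > 0"
    and "\<And>j k a b. (j, k) \<in> parcs G \<Longrightarrow> C j k $ a $ b \<ge> 0"
    and "\<And>j k. (j, k) \<in> parcs G \<Longrightarrow> C k j = transpose (C j k)"
  defines "\<K> \<equiv> gibbs_tensor \<epsilon> (cost_tensor G C)"
    and "K \<equiv> \<lambda>j k. gibbs_matrix \<epsilon> (C j k)"
    and "\<U> \<equiv> outer_product J u"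
  shows "(\<exists>\<alpha>. alpha_recursion G K u \<alpha>) \<and>
    (\<forall>\<alpha>. alpha_recursion G K u \<alpha> \<longrightarrow>
      (\<forall>j\<in>{1..J}. tensor_proj J j (\<K> \<odot> \<U>) = u j * (\<Prod>k\<in>neighbours G j. \<alpha> j k)))"
proof (intro conjI allI impI ballI)
  show "\<exists>\<alpha>. alpha_recursion G K u \<alpha>"
    by (rule alpha_recursion_exists) fact
next
  fix \<alpha> j
  assume \<alpha>: "alpha_recursion G K u \<alpha>" and j: "j \<in> {1..J}"
  interpret pair_graph G using assms(1) by (simp add: undirected_tree_def)
  interpret tree_messages G "\<lambda>j k a b. K j k $ a $ b" "\<lambda>j a. u j $ a" "\<lambda>j k a. \<alpha> j k $ a"
  proof unfold_locales
    show "K k j $ b $ a = K j k $ a $ b" if "(j, k) \<in> parcs G" for j k a b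
      using assms(5)[OF that] by (simp add: K_def gibbs_matrix_def transpose_def)
    show "\<alpha> j k $ a = (\<Sum>b\<in>UNIV. K j k $ a $ b *
        (u k $ b * (\<Prod>l\<in>neighbours G k - {j}. \<alpha> k l $ b)))" if "(j, k) \<in> parcs G" for j k a
    proof -
      have "\<alpha> j k = K j k *v (u k * (\<Prod>l\<in>neighbours G k - {j}. \<alpha> k l))"
        using \<alpha> that by (simp add: alpha_recursion_iff[OF pair_graph_axioms])
      then show ?thesis by (simp add: matrix_vector_mult_def prod_vec_nth)
    qed
  qed
  have "(\<K> \<odot> \<U>) i = weight {1..J} i" for i
    using weight_pverts[of i] pair_finite_arcs assms(2)
    by (simp add: tensor_hadamard_def \<K>_def K_def \<U>_def gibbs_tensor_cost outer_product_def)
  \<comment> \<open>The tree is rooted at \<open>j\<close> because the root's index is the one held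
    fixed in the sum.\<close>
  moreover have "grown G j {1..J}"
    using undirected_tree_grown[OF assms(1)] j assms(2) by simp
  ultimately show "tensor_proj J j (\<K> \<odot> \<U>) = u j * (\<Prod>k\<in>neighbours G j. \<alpha> j k)"
    by (simp add: vec_eq_iff tensor_proj_def multi_indices_def grown_sum_weight prod_vec_nth)
qed

end
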